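(* Let $$I_{7}= \frac{24}{7 \sqrt{7}}\int_{\pi/3}^{\pi/2}\ln\left|\frac{\tan(\theta) + \sqrt{7}}{\tan(\theta)-\sqrt{7}}\right|\,d\theta$$ and let $\phi_{7}=\tan^{-1}(\sqrt{7})$. Then $$I_{7}= \frac{4}{7 \sqrt{7}} \left[3\, \mathrm{Cl}_2(2\phi_{7})-3\, \mathrm{Cl}_2(4\phi_{7})+\mathrm{Cl}_2(6\phi_{7})\right],$$ where $\mathrm{Cl}_2$ denotes the Clausen function of order 2.
   Context: The Clausen function (of order 2) is the real function defined for all $\theta\in\mathbb{R}$ by $$\mathrm{Cl}_2(\theta)= \sum_{m=1}^{\infty} \frac{\sin(m\theta)}{m^2}=-\int_{0}^{\theta}\ln\left|2 \sin \left(\frac{t}{2}\right)\right|dt .$$ Here $\tan^{-1}$ is the principal branch of the arctangent, so $\phi_7\approx 1.2094$. The integrand defining $I_7$ has a single logarithmic singularity inside $(\pi/3,\pi/2)$, at $\theta=\phi_7$; it is integrable, and the integral is understood as the (absolutely convergent) improper or Lebesgue integral. *)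

theory Defs
  imports "HOL-Analysis.Analysis"
begin

definition clausen2 :: "real \<Rightarrow> real" where
  "clausen2 \<theta> = (\<Sum>n. sin (real (Suc n) * \<theta>) / (real (Suc n))\<^sup>2)"

lemma summable_clausen2: "summable (\<lambda>n. sin (real (Suc n) * \<theta>) / (real (Suc n))\<^sup>2)"
proof (rule summable_comparison_test')
  show "summable (\<lambda>n. 1 / (real (Suc n))\<^sup>2)"
    using inverse_power_summable[of 2, where ?'a = real]
      summable_Suc_iff[of "\<lambda>n. inverse ((real n)\<^sup>2)"]
    by (simp add: inverse_eq_divide del: of_nat_Suc)
  show "norm (sin (real (Suc n) * \<theta>) / (real (Suc n))\<^sup>2) \<le> 1 / (real (Suc n))\<^sup>2" for n
    by (simp add: abs_divide divide_right_mono del: of_nat_Suc)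
qed

definition \<phi>7 :: real where
  "\<phi>7 = arctan (sqrt 7)"

text \<open>HOL's conventions \<open>tan (pi / 2) = 0\<close>, \<open>x / 0 = 0\<close> and \<open>ln 0 = 0\<close> affect the integrand on
  \<open>{pi/3..pi/2}\<close> only at the two points \<open>pi / 2\<close> and \<open>\<phi>7\<close>, a null set.\<close>

definition I7_integrand :: "real \<Rightarrow> real" where
  "I7_integrand \<theta> = ln \<bar>(tan \<theta> + sqrt 7) / (tan \<theta> - sqrt 7)\<bar>"

definition I7 :: real where
  "I7 = 24 / (7 * sqrt 7) * (LINT \<theta>:{pi/3..pi/2}|lborel. I7_integrand \<theta>)"

end

theory Submission
  imports Defs
begin

text \<open>With \<open>tan \<phi>7 = sqrt 7\<close> the integrand becomes
  \<open>ln \<bar>2 * sin (\<theta> + \<phi>7)\<bar> - ln \<bar>2 * sin (\<theta> - \<phi>7)\<bar>\<close>. Since \<open>clausen2\<close> is continuous with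
  derivative \<open>- ln \<bar>2 * sin (x / 2)\<bar>\<close> off \<open>2 * pi * \<int>\<close>, the continuous function
  \<open>(clausen2 (2 * \<theta> - 2 * \<phi>7) - clausen2 (2 * \<theta> + 2 * \<phi>7)) / 2\<close> is a primitive across the
  singularity, and the duplication and triplication formulas evaluate its end point values at
  \<open>pi / 2\<close> and \<open>pi / 3\<close>. Integrability follows from nonnegativity of the integrand.\<close>

section \<open>The dilogarithm on the closed unit disc and its imaginary part on the circle\<close>

text \<open>The term \<open>n = 0\<close> vanishes because \<open>1 / 0 = 0\<close>.\<close>

definition dilog :: "complex \<Rightarrow> complex" where
  "dilog z = (\<Sum>n. z ^ n / (of_nat n)\<^sup>2)"

lemma summable_dilog:
  fixes z :: complex
  assumes "norm z \<le> 1"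
  shows "summable (\<lambda>n. z ^ n / (of_nat n)\<^sup>2)"
proof (rule summable_comparison_test')
  show "summable (\<lambda>n. 1 / (real n)\<^sup>2)"
    using inverse_power_summable[of 2, where ?'a = real] by (simp add: inverse_eq_divide)
  show "norm (z ^ n / (of_nat n)\<^sup>2) \<le> 1 / (real n)\<^sup>2" for n
    using assms by (simp add: norm_divide norm_power power_le_one divide_right_mono)
qed

text \<open>The majorant \<open>1 / n^2\<close> works up to the boundary, so the M-test covers the
  unit circle as well. Limits \<open>r \<longlonglongrightarrow> 1\<close> along a radius rely on
  this.\<close>

lemma continuous_on_dilog: "continuous_on (cball 0 1) dilog"
proof (rule uniform_limit_theorem)
  have "summable (\<lambda>n. 1 / (real n)\<^sup>2)"
    using inverse_power_summable[of 2, where ?'a = real] by (simp add: inverse_eq_divide)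
  then show "uniform_limit (cball 0 1) (\<lambda>N z. \<Sum>n<N. z ^ n / (of_nat n)\<^sup>2) dilog sequentially"
    unfolding dilog_def
    by (rule Weierstrass_m_test[rotated])
       (auto simp: norm_divide norm_power power_le_one divide_right_mono)
  show "\<forall>\<^sub>F N in sequentially. continuous_on (cball 0 1) (\<lambda>z::complex. \<Sum>n<N. z ^ n / (of_nat n)\<^sup>2)"
    unfolding divide_inverse
    by (intro always_eventually allI continuous_on_sum continuous_on_mult continuous_on_power
        continuous_on_const continuous_on_id)
qed simp

lemma clausen2_eq_Im_dilog: "clausen2 x = Im (dilog (cis x))"
proof -
  have s: "summable (\<lambda>n. cis x ^ n / (of_nat n)\<^sup>2)"
    by (rule summable_dilog) simp
  have "Im (dilog (cis x)) = (\<Sum>n. Im (cis x ^ n / (of_nat n)\<^sup>2))"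
    unfolding dilog_def using s by (rule Im_suminf)
  also have "\<dots> = (\<Sum>n. sin (real n * x) / (real n)\<^sup>2)"
  proof -
    have "Im (cis x ^ n / (of_nat n)\<^sup>2) = sin (real n * x) / (real n)\<^sup>2" for n
      using Im_divide_of_real[of "cis x ^ n" "(real n)\<^sup>2"] by (simp add: Complex.DeMoivre)
    then show ?thesis
      by (intro suminf_cong)
  qed
  also have "\<dots> = clausen2 x"
    using suminf_split_head[of "\<lambda>n. sin (real n * x) / (real n)\<^sup>2"] summable_clausen2[of x]
      summable_Suc_iff[of "\<lambda>n. sin (real n * x) / (real n)\<^sup>2"]
    by (simp add: clausen2_def del: of_nat_Suc)
  finally show ?thesis ..
qed

lemma continuous_on_clausen2: "continuous_on S clausen2"
  unfolding clausen2_eq_Im_dilog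
  by (intro continuous_intros continuous_on_compose2[OF continuous_on_dilog]) auto

lemma clausen2_minus: "clausen2 (- x) = - clausen2 x"
  using suminf_minus[OF summable_clausen2[of x]] by (simp add: clausen2_def)

lemma clausen2_periodic: "clausen2 (x + 2 * pi) = clausen2 x"
  by (simp add: clausen2_eq_Im_dilog flip: cis_mult)

section \<open>Derivatives of the dilogarithm and of the Clausen function\<close>

text \<open>Termwise differentiation followed by multiplication by \<open>z\<close> gives the series
  of \<open>- Ln (1 - z)\<close>. The product form includes \<open>z = 0\<close> without a case
  split, and differentiation along a circle needs only \<open>z * D\<close>.\<close>

lemma has_field_derivative_dilog:
  assumes "norm z < 1"
  obtains D where "(dilog has_field_derivative D) (at z)" "z * D = - Ln (1 - z)"
proof
  show "(dilog has_field_derivative (\<Sum>n. diffs (\<lambda>n. 1 / (of_nat n)\<^sup>2) n * z ^ n)) (at z)"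
    using termdiffs_strong[of "\<lambda>n. 1 / (of_nat n)\<^sup>2" 1 z] summable_dilog[of 1] assms
    unfolding dilog_def by simp
  have "(\<lambda>n. z ^ n / of_nat n) sums (- Ln (1 - z))"
    using sums_minus[OF Ln_series'[of "- z"]] assms by simp
  \<comment> \<open>The term at \<open>n = 0\<close> is \<open>1 / 0 = 0\<close>, so the index shift
    leaves the sum unchanged.\<close>
  then have sums: "(\<lambda>n. z ^ Suc n / of_nat (Suc n)) sums (- Ln (1 - z))"
    by (subst sums_Suc_iff) simp
  have eq: "z * (diffs (\<lambda>n. 1 / (of_nat n)\<^sup>2) n * z ^ n) = z ^ Suc n / of_nat (Suc n)" for n
    by (simp add: diffs_def power2_eq_square del: of_nat_Suc)
  have "summable (\<lambda>n. diffs (\<lambda>n. 1 / (of_nat n)\<^sup>2) n * z ^ n)"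
  proof (rule termdiff_converges[where K = 1])
    show "norm z < 1" by fact
  next
    fix w :: complex assume "norm w < 1"
    then show "summable (\<lambda>n. 1 / (of_nat n)\<^sup>2 * w ^ n)"
      using summable_dilog[of w] by simp
  qed
  then have "z * (\<Sum>n. diffs (\<lambda>n. 1 / (of_nat n)\<^sup>2) n * z ^ n) =
      (\<Sum>n. z * (diffs (\<lambda>n. 1 / (of_nat n)\<^sup>2) n * z ^ n))"
    by (rule suminf_mult[symmetric])
  also have "\<dots> = - Ln (1 - z)"
    unfolding eq by (rule sums_unique[OF sums, symmetric])
  finally show "z * (\<Sum>n. diffs (\<lambda>n. 1 / (of_nat n)\<^sup>2) n * z ^ n) = - Ln (1 - z)" .
qed

text \<open>The circle \<open>z = r * cis x\<close> has velocity \<open>\<i> * z\<close>, so the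
  chain rule gives \<open>- \<i> * Ln (1 - z)\<close>, whose imaginary part is
  \<open>- Re (Ln (1 - z))\<close>.\<close>

lemma has_real_derivative_Im_dilog:
  assumes "0 \<le> r" "r < 1"
  shows "((\<lambda>x. Im (dilog (of_real r * cis x))) has_real_derivative
      - ln (norm (1 - of_real r * cis x))) (at x)"
proof -
  define z where "z = of_real r * cis x"
  have z: "norm z < 1"
    using assms by (simp add: z_def norm_mult)
  obtain D where D: "(dilog has_field_derivative D) (at z)" "z * D = - Ln (1 - z)"
    using has_field_derivative_dilog[OF z] .
  have "((\<lambda>x. of_real r * cis x) has_vector_derivative \<i> * z) (at x)"
    unfolding z_def cis_conv_exp
    by (auto intro!: derivative_eq_intros has_vector_derivative_real_field)
  then have "((dilog \<circ> (\<lambda>x. of_real r * cis x)) has_vector_derivative (\<i> * z) * D) (at x)"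
    using D(1) unfolding z_def by (rule field_vector_diff_chain_at)
  then have "((\<lambda>x. Im (dilog (of_real r * cis x))) has_vector_derivative Im ((\<i> * z) * D)) (at x)"
    unfolding o_def
    by (rule bounded_linear.has_vector_derivative[OF bounded_linear_Im])
  moreover have "1 - z \<noteq> 0"
    using z by auto
  then have "Im ((\<i> * z) * D) = - ln (norm (1 - z))"
    using D(2) by (simp add: mult.assoc Re_Ln)
  ultimately show ?thesis
    by (simp add: has_real_derivative_iff_has_vector_derivative z_def)
qed

text \<open>At \<open>\<bar>z\<bar> = 1\<close> termwise differentiation yields only a conditionally convergent series. Instead let
  \<open>r\<close> tend to \<open>1\<close> in \<open>Im (dilog (r * cis y))\<close>: away from \<open>cis y = 1\<close> the derivatives
  \<open>- ln \<bar>1 - r * cis y\<bar>\<close> converge locally uniformly.\<close>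

lemma has_real_derivative_clausen2:
  assumes "cis x \<noteq> 1"
  shows "(clausen2 has_real_derivative - ln (norm (1 - cis x))) (at x)"
proof -
  \<comment> \<open>One third leaves room twice: \<open>norm (1 - cis y)\<close> stays above
    \<open>2 * d\<close> near \<open>x\<close>, and any point of the disc within \<open>d\<close> of
    such a \<open>cis y\<close> still lies in \<open>K\<close>, away from the singularity at
    1.\<close>
  define d where "d = norm (1 - cis x) / 3"
  have d: "d > 0" "2 * d < norm (1 - cis x)"
    using assms by (auto simp: d_def)
  define K where "K = {z. norm (1 - z) \<ge> d} \<inter> cball (0::complex) 1"
  have "compact K"
    unfolding K_def by (intro closed_Int_compact closed_Collect_le continuous_intros compact_cball)
  have "isCont (\<lambda>y. norm (1 - cis y)) x"
    by (rule continuous_on_interior[of UNIV]) (auto intro!: continuous_intros)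
  then have "\<forall>\<^sub>F y in at x. 2 * d < norm (1 - cis y)"
    using d(2) unfolding isCont_def by (rule order_tendstoD)
  then obtain e where e: "e > 0"
      "\<And>y. y \<noteq> x \<Longrightarrow> dist y x < e \<Longrightarrow> 2 * d < norm (1 - cis y)"
    unfolding eventually_at by blast
  define S where "S = ball x e"
  have S: "2 * d < norm (1 - cis y)" if "y \<in> S" for y
    using that e(2)[of y] d(2) by (cases "y = x") (auto simp: S_def dist_commute)
  define r where "r n = 1 - 1 / real (Suc n)" for n
  have r: "0 \<le> r n" "r n < 1" for n
    by (auto simp: r_def)
  have r_lim: "r \<longlonglongrightarrow> 1"
    unfolding r_def using tendsto_diff[OF tendsto_const LIMSEQ_Suc[OF lim_1_over_n]] by simp
  have lim: "(\<lambda>n. Im (dilog (of_real (r n) * cis y))) \<longlonglongrightarrow> clausen2 y" for y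
  proof -
    have "(\<lambda>n. of_real (r n) * cis y) \<longlonglongrightarrow> of_real 1 * cis y"
      by (intro tendsto_intros r_lim)
    then have "(\<lambda>n. dilog (of_real (r n) * cis y)) \<longlonglongrightarrow> dilog (of_real 1 * cis y)"
      by (rule continuous_on_tendsto_compose[OF continuous_on_dilog])
         (auto simp: norm_mult r less_imp_le)
    then show ?thesis
      unfolding clausen2_eq_Im_dilog by (auto intro: tendsto_Im)
  qed
  \<comment> \<open>Uniform continuity on the compact \<open>K\<close> turns closeness of
    \<open>r n * cis y\<close> to \<open>cis y\<close> into uniform closeness of the
    derivatives.\<close>
  have "continuous_on K (\<lambda>z. ln (norm (1 - z)))"
    using d(1) by (intro continuous_intros) (auto simp: K_def)
  then have uc: "uniformly_continuous_on K (\<lambda>z. ln (norm (1 - z)))"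
    using \<open>compact K\<close> by (rule compact_uniformly_continuous)
  have "\<exists>g. \<forall>y\<in>S. (\<lambda>n. Im (dilog (of_real (r n) * cis y))) \<longlonglongrightarrow> g y \<and>
      (g has_derivative (*) (- ln (norm (1 - cis y)))) (at y within S)"
  proof (rule has_derivative_sequence)
    show "convex S" "x \<in> S"
      using e(1) by (auto simp: S_def)
    show "((\<lambda>y. Im (dilog (of_real (r n) * cis y))) has_derivative
        (*) (- ln (norm (1 - of_real (r n) * cis y)))) (at y within S)" for n y
      using has_real_derivative_Im_dilog[OF r[of n], of y]
      by (auto intro: has_derivative_at_withinI simp: has_field_derivative_def)
    show "(\<lambda>n. Im (dilog (of_real (r n) * cis x))) \<longlonglongrightarrow> clausen2 x"
      by (rule lim)
  next
    fix \<epsilon> :: real assume "\<epsilon> > 0"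
    then obtain \<delta> where \<delta>: "\<delta> > 0" "\<And>z w. z \<in> K \<Longrightarrow> w \<in> K \<Longrightarrow> dist w z < \<delta> \<Longrightarrow>
        dist (ln (norm (1 - w))) (ln (norm (1 - z))) < \<epsilon>"
      using uc unfolding uniformly_continuous_on_def by metis
    \<comment> \<open>The bound \<open>d\<close> keeps \<open>r n * cis y\<close> in
      \<open>K\<close>; the bound \<open>\<delta>\<close> serves the uniform continuity.\<close>
    have "\<forall>\<^sub>F n in sequentially. 1 - min d \<delta> < r n"
      using r_lim by (rule order_tendstoD) (use d(1) \<delta>(1) in auto)
    then show "\<forall>\<^sub>F n in sequentially. \<forall>y\<in>S. \<forall>h.
        norm (- ln (norm (1 - of_real (r n) * cis y)) * h - - ln (norm (1 - cis y)) * h) \<le> \<epsilon> * norm h"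
    proof (rule eventually_mono, intro ballI allI)
      fix n y h assume n: "1 - min d \<delta> < r n" and y: "y \<in> S"
      define w where "w = of_real (r n) * cis y"
      have "w - cis y = of_real (r n - 1) * cis y"
        by (simp add: w_def algebra_simps)
      then have "dist w (cis y) = \<bar>r n - 1\<bar>"
        by (simp only: dist_norm norm_mult norm_of_real norm_cis mult_1_right)
      then have dist: "dist w (cis y) < min d \<delta>"
        using n r(2)[of n] by linarith
      have "norm (1 - cis y) \<le> norm (1 - w) + dist w (cis y)"
        using norm_triangle_ineq[of "1 - w" "w - cis y"] by (simp add: dist_norm)
      then have "w \<in> K" "cis y \<in> K"
        using S[OF y] dist d(1) r[of n] by (auto simp: K_def w_def norm_mult)
      then have "dist (ln (norm (1 - w))) (ln (norm (1 - cis y))) < \<epsilon>"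
        using \<delta>(2) dist by simp
      then have "\<bar>ln (norm (1 - w)) - ln (norm (1 - cis y))\<bar> * \<bar>h\<bar> \<le> \<epsilon> * \<bar>h\<bar>"
        by (intro mult_right_mono) (auto simp: dist_real_def)
      moreover have "- ln (norm (1 - w)) * h - - ln (norm (1 - cis y)) * h =
          - ((ln (norm (1 - w)) - ln (norm (1 - cis y))) * h)"
        by (simp add: algebra_simps)
      ultimately show "norm (- ln (norm (1 - of_real (r n) * cis y)) * h - - ln (norm (1 - cis y)) * h)
          \<le> \<epsilon> * norm h"
        by (simp only: w_def real_norm_def abs_minus_cancel abs_mult)
    qed
  qed
  then obtain g where g: "\<And>y. y \<in> S \<Longrightarrow> (\<lambda>n. Im (dilog (of_real (r n) * cis y))) \<longlonglongrightarrow> g y"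
    "\<And>y. y \<in> S \<Longrightarrow> (g has_derivative (*) (- ln (norm (1 - cis y)))) (at y within S)"
    by blast
  have eq: "clausen2 y = g y" if "y \<in> S" for y
    using lim g(1)[OF that] by (rule LIMSEQ_unique)
  have "x \<in> S" "open S"
    using e(1) by (auto simp: S_def)
  from this(1) have "(clausen2 has_derivative (*) (- ln (norm (1 - cis x)))) (at x within S)"
    by (rule has_derivative_transform[OF _ eq g(2)[OF \<open>x \<in> S\<close>]])
  then show ?thesis
    by (simp only: has_field_derivative_def at_within_open[OF \<open>x \<in> S\<close> \<open>open S\<close>])
qed

lemma norm_one_minus_cis: "norm (1 - cis x) = 2 * \<bar>sin (x / 2)\<bar>"
  using dist_exp_i_1[of x] by (simp add: cis_conv_exp norm_minus_commute)

lemma has_real_derivative_clausen2':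
  assumes "sin (x / 2) \<noteq> 0"
  shows "(clausen2 has_real_derivative - ln \<bar>2 * sin (x / 2)\<bar>) (at x)"
proof -
  have "cis x \<noteq> 1"
    using assms norm_one_minus_cis[of x] by auto
  from has_real_derivative_clausen2[OF this] show ?thesis
    by (simp add: norm_one_minus_cis abs_mult)
qed

section \<open>Multiplication formulas from roots of unity\<close>

text \<open>With \<open>n\<close> fixed, the summands are the powers \<open>\<omega> ^ k\<close> of
  a single m-th root of unity, so the sum is geometric, and \<open>\<omega> = 1\<close> exactly when
  \<open>m\<close> divides \<open>n\<close>.\<close>

lemma sum_powers_root_of_unity:
  fixes m n :: nat
  assumes "m > 0"
  shows "(\<Sum>k<m. cis (2 * pi * real k / real m) ^ n) = (if m dvd n then of_nat m else 0)"
proof -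
  define \<omega> where "\<omega> = cis (2 * pi * real n / real m)"
  have eq: "cis (2 * pi * real k / real m) ^ n = \<omega> ^ k" for k
    by (simp add: \<omega>_def Complex.DeMoivre mult_ac)
  have \<omega>_eq_1: "\<omega> = 1 \<longleftrightarrow> m dvd n"
    using complex_root_unity_eq_1[of m n] assms
    by (simp add: \<omega>_def cis_conv_exp mult_ac)
  have "\<omega> ^ m = 1"
    using assms cis_multiple_2pi[of "real n"] by (simp add: \<omega>_def Complex.DeMoivre)
  then have "(\<Sum>k<m. \<omega> ^ k) = (if m dvd n then of_nat m else 0)"
    using \<omega>_eq_1 by (auto simp: geometric_sum)
  then show ?thesis
    by (simp add: eq)
qed

text \<open>Summing over the rotations by m-th roots of unity keeps only the exponents
  \<open>m * n\<close>, each with coefficient \<open>m / (m * n)^2 = 1 / (m * n^2)\<close>.\<close>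

lemma dilog_multiplication:
  assumes "m > 0" "norm z \<le> 1"
  shows "(\<Sum>k<m. dilog (z * cis (2 * pi * real k / real m))) = dilog (z ^ m) / of_nat m"
proof -
  let ?\<omega> = "\<lambda>k. cis (2 * pi * real k / real m)"
  have "(\<lambda>n. (z ^ m) ^ n / (of_nat n)\<^sup>2) sums dilog (z ^ m)"
    unfolding dilog_def using assms
    by (intro summable_sums summable_dilog) (simp add: norm_power power_le_one)
  then have "(\<lambda>n. (z ^ m) ^ n / (of_nat n)\<^sup>2 / of_nat m) sums (dilog (z ^ m) / of_nat m)"
    by (rule sums_divide)
  moreover have "(z ^ m) ^ n / (of_nat n)\<^sup>2 / of_nat m =
      (\<Sum>k<m. (z * ?\<omega> k) ^ (m * n) / (of_nat (m * n))\<^sup>2)" for n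
    using assms
    by (simp add: power_mult_distrib sum_powers_root_of_unity power2_eq_square
        flip: sum_divide_distrib sum_distrib_left power_mult)
  ultimately have "(\<lambda>n. \<Sum>k<m. (z * ?\<omega> k) ^ (m * n) / (of_nat (m * n))\<^sup>2) sums
      (dilog (z ^ m) / of_nat m)"
    by simp
  then have "(\<lambda>n. \<Sum>k<m. (z * ?\<omega> k) ^ n / (of_nat n)\<^sup>2) sums (dilog (z ^ m) / of_nat m)"
  proof (subst (asm) sums_mono_reindex[where f = "\<lambda>n. \<Sum>k<m. (z * ?\<omega> k) ^ n / (of_nat n)\<^sup>2"])
    show "strict_mono ((*) m)"
      using assms by (simp add: strict_mono_def)
    show "(\<Sum>k<m. (z * ?\<omega> k) ^ n / (of_nat n)\<^sup>2) = 0" if "n \<notin> range ((*) m)" for n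
    proof -
      have "\<not> m dvd n"
        using that by (auto elim: dvdE)
      then show ?thesis
        using assms by (simp add: power_mult_distrib sum_powers_root_of_unity
            flip: sum_divide_distrib sum_distrib_left)
    qed
  qed
  moreover have "(\<lambda>n. \<Sum>k<m. (z * ?\<omega> k) ^ n / (of_nat n)\<^sup>2) sums (\<Sum>k<m. dilog (z * ?\<omega> k))"
    unfolding dilog_def using assms
    by (intro sums_sum summable_sums summable_dilog) (simp add: norm_mult)
  ultimately show ?thesis
    by (rule sums_unique2[rotated])
qed

lemma clausen2_multiplication:
  assumes "m > 0"
  shows "(\<Sum>k<m. clausen2 (x + 2 * pi * real k / real m)) = clausen2 (real m * x) / real m"
  using arg_cong[OF dilog_multiplication[OF assms, of "cis x"], of Im]
  by (simp add: clausen2_eq_Im_dilog Complex.DeMoivre cis_mult)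

lemma clausen2_duplication: "2 * clausen2 x + 2 * clausen2 (x + pi) = clausen2 (2 * x)"
  using clausen2_multiplication[of 2 x] by (simp add: numeral_2_eq_2)

lemma clausen2_triplication:
  "3 * clausen2 x + 3 * clausen2 (x + 2 * pi / 3) + 3 * clausen2 (x - 2 * pi / 3) = clausen2 (3 * x)"
proof -
  have "clausen2 (x + 4 * pi / 3) = clausen2 (x - 2 * pi / 3)"
    using clausen2_periodic[of "x - 2 * pi / 3"] by (simp add: algebra_simps)
  then show ?thesis
    using clausen2_multiplication[of 3 x] by (simp add: numeral_3_eq_3)
qed

section \<open>The integrand and its integral\<close>

lemma phi7_bounds: "pi / 3 < \<phi>7" "\<phi>7 < pi / 2"
proof -
  have "arctan (sqrt 3) < arctan (sqrt 7)"
    by (simp add: arctan_less_iff)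
  moreover have "arctan (sqrt 3) = pi / 3"
    using arctan_tan[of "pi / 3"] pi_gt_zero by (simp add: tan_60)
  ultimately show "pi / 3 < \<phi>7"
    by (simp add: \<phi>7_def)
  show "\<phi>7 < pi / 2"
    unfolding \<phi>7_def by (rule arctan_ubound)
qed

text \<open>Expanding the quotient by \<open>cos \<theta> * cos \<phi>7\<close> turns it into a
  ratio of sines by the addition formulas. The factors 2 cancel and are inserted to match the
  derivative of \<open>clausen2\<close>.\<close>

lemma I7_integrand_eq:
  assumes "pi / 3 \<le> \<theta>" "\<theta> < pi / 2" "\<theta> \<noteq> \<phi>7"
  shows "I7_integrand \<theta> = (ln \<bar>2 * sin (\<theta> + \<phi>7)\<bar>) - ln \<bar>2 * sin (\<theta> - \<phi>7)\<bar>"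
    and "sin (\<theta> + \<phi>7) \<noteq> 0" and "sin (\<theta> - \<phi>7) \<noteq> 0"
proof -
  have pos: "0 < sin (\<theta> + \<phi>7)"
    using assms phi7_bounds pi_gt_zero by (intro sin_gt_zero) linarith+
  then show "sin (\<theta> + \<phi>7) \<noteq> 0"
    by simp
  show nz: "sin (\<theta> - \<phi>7) \<noteq> 0"
    using assms phi7_bounds pi_gt_zero sin_gt_zero[of "\<theta> - \<phi>7"] sin_gt_zero[of "\<phi>7 - \<theta>"]
      sin_minus[of "\<theta> - \<phi>7"]
    by (cases "\<theta> < \<phi>7") fastforce+
  have "cos \<theta> \<noteq> 0" "cos \<phi>7 \<noteq> 0"
    using assms phi7_bounds pi_gt_zero cos_gt_zero_pi[of \<theta>] cos_gt_zero_pi[of \<phi>7] by auto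
  moreover have "tan \<phi>7 = sqrt 7"
    by (simp add: \<phi>7_def tan_arctan)
  ultimately have "(tan \<theta> + sqrt 7) / (tan \<theta> - sqrt 7) = sin (\<theta> + \<phi>7) / sin (\<theta> - \<phi>7)"
    using nz by (simp add: tan_def sin_add sin_diff divide_simps mult.commute flip: \<open>tan \<phi>7 = sqrt 7\<close>)
  then show "I7_integrand \<theta> = (ln \<bar>2 * sin (\<theta> + \<phi>7)\<bar>) - ln \<bar>2 * sin (\<theta> - \<phi>7)\<bar>"
    using pos nz by (simp add: I7_integrand_def ln_div abs_mult ln_mult)
qed

lemma I7_integrand_nonneg:
  assumes "\<theta> \<in> {pi/3..pi/2}"
  shows "0 \<le> I7_integrand \<theta>"
proof (cases "tan \<theta> = sqrt 7")
  case False
  have "0 \<le> tan \<theta>"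
  proof (cases "\<theta> = pi / 2")
    case False
    then have "0 < tan \<theta>"
      using assms pi_gt_zero by (intro tan_gt_zero) auto
    then show ?thesis
      by simp
  \<comment> \<open>At \<open>pi / 2\<close> the cosine vanishes and division by zero makes the
    tangent 0.\<close>
  qed (simp add: tan_def cos_pi_half del: divide_const_simps)
  moreover have "0 \<le> sqrt 7"
    by simp
  ultimately have "\<bar>tan \<theta> - sqrt 7\<bar> \<le> \<bar>tan \<theta> + sqrt 7\<bar>"
    by linarith
  then show ?thesis
    using False by (simp add: I7_integrand_def abs_divide divide_simps)
qed (simp add: I7_integrand_def)

lemma borel_measurable_I7_integrand: "I7_integrand \<in> borel_measurable borel"
  unfolding I7_integrand_def[abs_def] tan_def by measurable

lemma has_integral_I7_integrand:
  "(I7_integrand has_integral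
      (3 * clausen2 (2 * \<phi>7) - 3 * clausen2 (4 * \<phi>7) + clausen2 (6 * \<phi>7)) / 6) {pi/3..pi/2}"
proof -
  define H where "H \<theta> = (clausen2 (2 * \<theta> - 2 * \<phi>7) - clausen2 (2 * \<theta> + 2 * \<phi>7)) / 2" for \<theta>
  \<comment> \<open>This form of the theorem asks for a derivative only off a finite set, so
    continuity of \<open>H\<close> suffices at \<open>\<phi>7\<close> and at the end points.\<close>
  have FTC: "(I7_integrand has_integral (H (pi/2) - H (pi/3))) {pi/3..pi/2}"
  proof (rule fundamental_theorem_of_calculus_interior_strong)
    show "finite {\<phi>7}" "pi / 3 \<le> pi / 2"
      by auto
    show "continuous_on {pi/3..pi/2} H"
      unfolding H_def
      by (intro continuous_intros continuous_on_compose2[OF continuous_on_clausen2[of UNIV]]) auto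
    show "(H has_vector_derivative I7_integrand \<theta>) (at \<theta>)"
      if "\<theta> \<in> {pi/3<..<pi/2} - {\<phi>7}" for \<theta>
    proof -
      have \<theta>: "pi / 3 \<le> \<theta>" "\<theta> < pi / 2" "\<theta> \<noteq> \<phi>7"
        using that by auto
      have "sin ((2 * \<theta> - 2 * \<phi>7) / 2) \<noteq> 0" "sin ((2 * \<theta> + 2 * \<phi>7) / 2) \<noteq> 0"
        using I7_integrand_eq(2,3)[OF \<theta>] by (auto simp: diff_divide_distrib add_divide_distrib)
      note D = this[THEN has_real_derivative_clausen2']
      have "(H has_real_derivative
          (- ln \<bar>2 * sin ((2 * \<theta> - 2 * \<phi>7) / 2)\<bar> * 2 - - ln \<bar>2 * sin ((2 * \<theta> + 2 * \<phi>7) / 2)\<bar> * 2) / 2) (at \<theta>)"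
        unfolding H_def
        by (intro DERIV_cdivide DERIV_diff
              DERIV_chain2[where f = clausen2 and g = "\<lambda>\<theta>. 2 * \<theta> - 2 * \<phi>7" and x = \<theta>, OF D(1)]
              DERIV_chain2[where f = clausen2 and g = "\<lambda>\<theta>. 2 * \<theta> + 2 * \<phi>7" and x = \<theta>, OF D(2)])
           (auto intro!: derivative_eq_intros)
      then show ?thesis
        using I7_integrand_eq(1)[OF \<theta>]
        by (simp add: has_real_derivative_iff_has_vector_derivative diff_divide_distrib add_divide_distrib)
    qed
  qed
  \<comment> \<open>Oddness and periodicity bring the end point values into the shifts by
    \<open>pi\<close> and \<open>2 * pi / 3\<close> that the two formulas eliminate:
    \<open>H (pi/2)\<close> becomes
    \<open>clausen2 (2 * \<phi>7) - clausen2 (4 * \<phi>7) / 2\<close>, and \<open>H (pi/3)\<close>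
    becomes \<open>clausen2 (2 * \<phi>7) / 2 - clausen2 (6 * \<phi>7) / 6\<close>.\<close>
  have "clausen2 (pi - 2 * \<phi>7) = - clausen2 (2 * \<phi>7 + pi)"
    using clausen2_minus[of "pi - 2 * \<phi>7"] clausen2_periodic[of "2 * \<phi>7 - pi"]
    by (simp add: algebra_simps)
  moreover have "clausen2 (2 * pi / 3 - 2 * \<phi>7) = - clausen2 (2 * \<phi>7 - 2 * pi / 3)"
    using clausen2_minus[of "2 * \<phi>7 - 2 * pi / 3"] by simp
  moreover note clausen2_duplication[of "2 * \<phi>7"] clausen2_triplication[of "2 * \<phi>7"]
  moreover have "H (pi/2) = (clausen2 (pi - 2 * \<phi>7) - clausen2 (2 * \<phi>7 + pi)) / 2"
    "H (pi/3) = (clausen2 (2 * pi / 3 - 2 * \<phi>7) - clausen2 (2 * \<phi>7 + 2 * pi / 3)) / 2"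
    by (simp_all add: H_def add.commute)
  ultimately have "H (pi/2) - H (pi/3) =
      (3 * clausen2 (2 * \<phi>7) - 3 * clausen2 (4 * \<phi>7) + clausen2 (6 * \<phi>7)) / 6"
    by simp
  with FTC show ?thesis
    by simp
qed

theorem mainTheorem1:
  shows "set_integrable lborel {pi/3..pi/2} I7_integrand \<and>
    I7 = 4 / (7 * sqrt 7) *
      (3 * clausen2 (2 * \<phi>7) - 3 * clausen2 (4 * \<phi>7) + clausen2 (6 * \<phi>7))"
proof -
  note int = has_integral_I7_integrand
  have "I7_integrand absolutely_integrable_on {pi/3..pi/2}"
    using int I7_integrand_nonneg by (intro nonnegative_absolutely_integrable_1) auto
  then have set_int: "set_integrable lborel {pi/3..pi/2} I7_integrand"
    unfolding set_integrable_def
    \<comment> \<open>Absolute integrability refers to the completed measure; Borel measurability of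
      the integrand carries it over to \<open>lborel\<close>.\<close>
    by (subst (asm) integrable_completion) (use borel_measurable_I7_integrand in auto)
  have "(LINT \<theta>:{pi/3..pi/2}|lborel. I7_integrand \<theta>) =
      (3 * clausen2 (2 * \<phi>7) - 3 * clausen2 (4 * \<phi>7) + clausen2 (6 * \<phi>7)) / 6"
    using set_borel_integral_eq_integral(2)[OF set_int] int by (simp add: integral_unique)
  then show ?thesis
    using set_int by (simp add: I7_def)
qed

end
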